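(* Let $k$ be a field and let $A$ be a standard graded $k$-algebra of Krull dimension $d \geq 1$ with Hilbert series $$\mathrm{Hilb}(A,t) = \frac{h_0 + \cdots + h_s t^s}{(1-t)^{d}}.$$ Then there is $R > 0$ such that for every integer $r > R$: (i) $h_i^{\langle r \rangle} \geq 1$ for $0 \leq i \leq d-1$; (ii) $h_i^{\langle r \rangle} = 0$ for $i \geq d+1$; (iii) $h^{\langle r \rangle}(t)$ has only real zeros. In particular, for $r > R$ the sequence $(h_0^{\langle r \rangle}, \ldots, h_d^{\langle r \rangle})$ is log-concave and unimodal.
   Context: A standard graded $k$-algebra is a graded $k$-algebra $A = \bigoplus_{n\ge 0} A_n$ (commutative) with $A_0 = k$ that is finitely generated as a $k$-algebra by elements of degree $1$. Its Hilbert series is $\mathrm{Hilb}(A,t) = \sum_{n\ge 0} \dim_k A_n\, t^n$; by the Hilbert–Serre theorem it has the form $h(t)/(1-t)^d$ with $h(t)$ a polynomial, $h(1)\geq 1$, and $d$ the Krull dimension of $A$. The $r$th Veronese algebra is $A^{\langle r\rangle} = \bigoplus_{n\ge 0} A_{nr}$, where $A_{nr}$ is the component of degree $n$, so $\mathrm{Hilb}(A^{\langle r\rangle},t) = \sum_{n\ge 0} \dim_k A_{rn}\, t^n$. It is of the form $h^{\langle r\rangle}(t)/(1-t)^d$ for a unique polynomial $h^{\langle r\rangle}(t)$, and $h_i^{\langle r\rangle}$ denotes the coefficient of $t^i$ in $h^{\langle r\rangle}(t)$. A real sequence $(c_0,\ldots,c_d)$ is log-concave if $c_i^2 \geq c_{i-1}c_{i+1}$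 for $1\le i\le d-1$, and unimodal if $c_0 \leq \cdots \leq c_j \geq \cdots \geq c_d$ for some $j$. *)

theory Defs
  imports
    "HOL-Computational_Algebra.Computational_Algebra"
    "HOL-Library.Extended_Nat"
    Complex_Main
begin

section \<open>Graded algebras over a field\<close>

text \<open>
  The homogeneous components \<open>G n\<close> are subspaces of an ambient commutative algebra, given by the
  type \<open>'a\<close>.  The underlying set of the graded algebra \<open>\<Oplus>\<^sub>n G n\<close> is the span of the
  components; it may be smaller than the ambient algebra, so that Veronese subalgebras are again
  instances.
\<close>

locale graded_algebra = vector_space scale
  for scale :: "'k::field \<Rightarrow> 'a::comm_ring_1 \<Rightarrow> 'a" (infixr \<open>*s\<close> 75) +
  fixes G :: "nat \<Rightarrow> 'a set"
  assumes scale_mult_left: "(c *s x) * y = c *s (x * y)"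
    and subspace_component: "subspace (G n)"
    and one_in_component: "1 \<in> G 0"
    and mult_in_component: "x \<in> G m \<Longrightarrow> y \<in> G n \<Longrightarrow> x * y \<in> G (m + n)"
    and direct_sum:
      "(\<And>n. n \<le> N \<Longrightarrow> u n \<in> G n) \<Longrightarrow> (\<Sum>n\<le>N. u n) = 0 \<Longrightarrow> n \<le> N \<Longrightarrow> u n = 0"

definition is_subalgebra :: "('k::field \<Rightarrow> 'a::comm_ring_1 \<Rightarrow> 'a) \<Rightarrow> 'a set \<Rightarrow> bool" where
  "is_subalgebra scale B \<longleftrightarrow>
     module.subspace scale B \<and> 1 \<in> B \<and> (\<forall>x\<in>B. \<forall>y\<in>B. x * y \<in> B)"

text \<open>The whole type is the algebra \<open>A\<close>; since \<open>1 \<noteq> 0\<close> in \<open>'a\<close>, the map \<open>c \<mapsto> c *s 1\<close> is injective,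
  so \<open>component_zero\<close> says \<open>A\<^sub>0 = k\<close>.\<close>

locale standard_graded_algebra = graded_algebra +
  assumes exhaustive: "span (\<Union>n. G n) = UNIV"
    and component_zero: "G 0 = range (\<lambda>c. scale c 1)"
    and generated_in_degree_one:
      "\<exists>S. finite S \<and> S \<subseteq> G 1 \<and> is_subalgebra scale hull S = UNIV"

definition hilbert_series ::
    "('k::field \<Rightarrow> 'a::comm_ring_1 \<Rightarrow> 'a) \<Rightarrow> (nat \<Rightarrow> 'a set) \<Rightarrow> real fps" where
  "hilbert_series scale G = Abs_fps (\<lambda>n. real (vector_space.dim scale (G n)))"

definition veronese :: "nat \<Rightarrow> (nat \<Rightarrow> 'a set) \<Rightarrow> nat \<Rightarrow> 'a set" where
  "veronese r G n = G (n * r)"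

lemma (in graded_algebra) graded_algebra_veronese:
  assumes "r > 0"
  shows "graded_algebra scale (veronese r G)"
proof
  fix c x y show "(c *s x) * y = c *s (x * y)" by (rule scale_mult_left)
next
  fix n show "subspace (veronese r G n)" by (simp add: veronese_def subspace_component)
next
  show "1 \<in> veronese r G 0" by (simp add: veronese_def one_in_component)
next
  fix x y m n assume "x \<in> veronese r G m" "y \<in> veronese r G n"
  then show "x * y \<in> veronese r G (m + n)"
    by (simp add: veronese_def mult_in_component add_mult_distrib)
next
  fix N n :: nat and u
  assume u: "\<And>n. n \<le> N \<Longrightarrow> u n \<in> veronese r G n" and s: "(\<Sum>n\<le>N. u n) = 0" and n: "n \<le> N"
  define v where "v m = (if r dvd m then u (m div r) else 0)" for m
  have v: "v m \<in> G m" if "m \<le> N * r" for m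
  proof (cases "r dvd m")
    case True
    then obtain k where k: "m = k * r" by (metis dvd_def mult.commute)
    with that assms have "k \<le> N" by simp
    with u[of k] k assms True show ?thesis by (simp add: v_def veronese_def)
  next
    case False
    then show ?thesis by (simp add: v_def subspace_0[OF subspace_component])
  qed
  have "(\<Sum>m\<le>N * r. v m) = (\<Sum>m\<in>(\<lambda>k. k * r) ` {..N}. v m)"
  proof (rule sum.mono_neutral_right)
    show "\<forall>i\<in>{..N * r} - (\<lambda>k. k * r) ` {..N}. v i = 0"
    proof
      fix i assume i: "i \<in> {..N * r} - (\<lambda>k. k * r) ` {..N}"
      have "\<not> r dvd i"
      proof
        assume "r dvd i"
        then obtain k where "i = k * r" by (metis dvd_def mult.commute)
        with i assms show False by auto
      qed
      then show "v i = 0" by (simp add: v_def)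
    qed
  qed auto
  also have "\<dots> = (\<Sum>k\<le>N. v (k * r))"
    using assms by (subst sum.reindex) (auto simp: inj_on_def)
  also have "\<dots> = 0" using s assms by (simp add: v_def)
  finally have "v (n * r) = 0" using direct_sum[of "N * r" v "n * r"] v n by simp
  then show "u n = 0" using assms by (simp add: v_def)
qed

text \<open>The unique polynomial \<open>p\<close> with \<open>H = p(t) / (1 - t)\<^sup>d\<close>, when there is one.\<close>

definition h_polynomial :: "nat \<Rightarrow> real fps \<Rightarrow> real poly" where
  "h_polynomial d H = (THE p. H = fps_of_poly p / (1 - fps_X) ^ d)"


section \<open>Krull dimension\<close>

definition is_prime_ideal :: "'a::comm_ring_1 set \<Rightarrow> bool" where
  "is_prime_ideal P \<longleftrightarrow>
     0 \<in> P \<and> (\<forall>x\<in>P. \<forall>y\<in>P. x + y \<in> P) \<and> (\<forall>a. \<forall>x\<in>P. a * x \<in> P) \<and>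
     P \<noteq> UNIV \<and> (\<forall>a b. a * b \<in> P \<longrightarrow> a \<in> P \<or> b \<in> P)"

definition krull_dim :: "'a::comm_ring_1 itself \<Rightarrow> enat" where
  "krull_dim _ = Sup {enat n |n. \<exists>P :: nat \<Rightarrow> 'a set.
     (\<forall>i\<le>n. is_prime_ideal (P i)) \<and> (\<forall>i<n. P i \<subset> P (Suc i))}"


section \<open>Log-concavity, unimodality, real zeros\<close>

text \<open>Only the entries \<open>c 0, \<dots>, c d\<close> matter.\<close>

definition log_concave_seq :: "nat \<Rightarrow> (nat \<Rightarrow> real) \<Rightarrow> bool" where
  "log_concave_seq d c \<longleftrightarrow> (\<forall>i. 1 \<le> i \<and> i + 1 \<le> d \<longrightarrow> (c i)\<^sup>2 \<ge> c (i - 1) * c (i + 1))"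

definition unimodal_seq :: "nat \<Rightarrow> (nat \<Rightarrow> real) \<Rightarrow> bool" where
  "unimodal_seq d c \<longleftrightarrow>
     (\<exists>j\<le>d. (\<forall>i<j. c i \<le> c (i + 1)) \<and> (\<forall>i. j \<le> i \<and> i < d \<longrightarrow> c i \<ge> c (i + 1)))"

definition only_real_zeros :: "real poly \<Rightarrow> bool" where
  "only_real_zeros p \<longleftrightarrow> (\<forall>z::complex. poly (map_poly complex_of_real p) z = 0 \<longrightarrow> z \<in> \<real>)"

end

theory Submission
  imports Defs
begin

text \<open>
  Write \<open>d = n + 1\<close>.  Partial fractions at the pole \<open>t = 1\<close> show that the Hilbert function of \<open>A\<close> is a
  polynomial \<open>\<Sum>m\<le>n. a m * k ^ m\<close> in the degree \<open>k\<close>, up to a finitely supported correction \<open>coeff q k\<close>.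
  Passing to the Veronese algebra replaces \<open>k\<close> by \<open>k * r\<close>; as soon as \<open>r > degree q\<close> only the correction
  in degree \<open>0\<close> survives.  Since \<open>\<Sum>k. k ^ m t ^ k = E\<^sub>m(t) / (1 - t) ^ (m + 1)\<close> with \<open>E\<^sub>m\<close> the Eulerian
  polynomial, the numerator of the Veronese series is explicitly
  \<open>\<Sum>m\<le>n. a m * r ^ m * E\<^sub>m(t) * (1 - t) ^ (n - m) + coeff q 0 * (1 - t) ^ (n + 1)\<close>.
  Its degree is at most \<open>d\<close>, its constant term is \<open>dim A\<^sub>0 = 1\<close>, and for \<open>n \<ge> 1\<close>, divided by \<open>r ^ n\<close>, it tends
  coefficientwise to \<open>a n * E\<^sub>n\<close>.

  So the theorem reduces to strict, hence stable, properties of \<open>E\<^sub>n\<close>, together with \<open>a n > 0\<close>.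
  The coefficients of \<open>E\<^sub>n\<close> at \<open>1, \<dots>, n\<close> are positive and strictly log-concave, by the Eulerian
  recurrence (\<open>eulerian_strictly_log_concave\<close>).  Rolle's argument, applied to \<open>E\<^sub>n(t) / (1 - t) ^ (n + 1)\<close>
  on the negative axis, gives \<open>n\<close> negative points at which \<open>E\<^sub>n\<close> has alternating signs, beginning with
  a negative value nearest to \<open>0\<close> (\<open>eulerian_alternating_points\<close>).  For large \<open>r\<close> the Veronese numerator has
  the same signs there, and the value \<open>1\<close> at \<open>0\<close>.  It therefore has \<open>n\<close> real zeros; as its degree is at
  most \<open>n + 1\<close>, no room is left for a pair of conjugate non-real zeros
  (\<open>only_real_zeros_of_alternating_values\<close>).

  That \<open>a n > 0\<close> is where the Krull dimension enters (\<open>leading_coefficient_pos\<close>).  Choosing an element in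
  each step of a chain of \<open>d + 1\<close> primes yields \<open>d\<close> algebraically independent elements, so the pieces of
  degree at most \<open>M\<close> together have dimension at least a constant times \<open>M ^ d\<close>.  If \<open>a n \<le> 0\<close>, that
  dimension would be \<open>O(M ^ (d - 1))\<close>.
\<close>

section \<open>Eulerian polynomials\<close>

text \<open>
  The Eulerian polynomials, normalised as the numerators of \<open>\<Sum>k. k ^ n t ^ k\<close>; thus \<open>eulerian 1 = t\<close>.
  The recursion is the operator \<open>t d/dt\<close>, carried out on \<open>eulerian n / (1 - t) ^ (n + 1)\<close>.
\<close>

primrec eulerian :: "nat \<Rightarrow> real poly" where
  "eulerian 0 = 1"
| "eulerian (Suc n) =
     pCons 0 ([:1, -1:] * pderiv (eulerian n) + smult (real (Suc n)) (eulerian n))"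

lemma coeff_eulerian_Suc_0 [simp]: "coeff (eulerian (Suc n)) 0 = 0"
  by simp

lemma coeff_eulerian_Suc_Suc:
  "coeff (eulerian (Suc n)) (Suc i) =
     real (Suc i) * coeff (eulerian n) (Suc i) + (real (Suc n) - real i) * coeff (eulerian n) i"
  by (cases i) (simp_all add: coeff_pderiv algebra_simps)

declare eulerian.simps(2) [simp del]

lemma coeff_eulerian_eq_0: "n < i \<Longrightarrow> coeff (eulerian n) i = 0"
proof (induction n arbitrary: i)
  case 0
  then show ?case by simp
next
  case (Suc n)
  then obtain j where "i = Suc j" "n < j" by (cases i) auto
  with Suc.IH show ?case by (simp add: coeff_eulerian_Suc_Suc)
qed

lemma degree_eulerian_le: "degree (eulerian n) \<le> n"
  by (rule degree_le) (simp add: coeff_eulerian_eq_0)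

lemma coeff_eulerian_pos: "1 \<le> i \<Longrightarrow> i \<le> n \<Longrightarrow> coeff (eulerian n) i > 0"
proof (induction n arbitrary: i)
  case 0
  then show ?case by simp
next
  case (Suc n)
  from Suc.prems obtain j where j: "i = Suc j" "j \<le> n" by (cases i) auto
  have ge: "coeff (eulerian n) k \<ge> 0" for k
  proof (cases "k = 0")
    case True
    then show ?thesis by (cases n) simp_all
  next
    case False
    then show ?thesis
      using Suc.IH[of k] coeff_eulerian_eq_0[of n k] by (cases "k \<le> n") auto
  qed
  show ?case
  proof (cases "j = 0")
    case True
    show ?thesis
    proof (cases "n = 0")
      case True
      with j \<open>j = 0\<close> show ?thesis by (simp add: coeff_eulerian_Suc_Suc)
    next
      case False
      with Suc.IH[of 1] ge[of 0] have "coeff (eulerian n) (Suc 0) > 0" by simp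
      with ge[of 0] show ?thesis
        unfolding j \<open>j = 0\<close> coeff_eulerian_Suc_Suc by (intro add_pos_nonneg mult_nonneg_nonneg) simp_all
    qed
  next
    case False
    with Suc.IH[of j] j have "coeff (eulerian n) j > 0" by simp
    with ge[of "Suc j"] j show ?thesis
      unfolding j coeff_eulerian_Suc_Suc by (intro add_nonneg_pos mult_nonneg_nonneg mult_pos_pos) simp_all
  qed
qed

lemma coeff_eulerian_nonneg: "coeff (eulerian n) i \<ge> 0"
proof (cases "i = 0")
  case True
  then show ?thesis by (cases n) simp_all
next
  case False
  then show ?thesis
    using coeff_eulerian_pos[of i n] coeff_eulerian_eq_0[of n i] by (cases "i \<le> n") auto
qed

text \<open>
  Let \<open>a, b, c, d\<close> be four consecutive coefficients of \<open>eulerian n\<close>.  By the recurrence, the new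
  coefficients are \<open>(s - 1) b + (t + 1) a\<close>, \<open>s c + t b\<close>, \<open>(s + 1) d + (t - 1) c\<close>, and the square of the
  middle one minus the product of the others is a combination, with nonnegative weights, of
  \<open>c\<^sup>2 - b d\<close>, \<open>b\<^sup>2 - a c\<close>, \<open>b c - a d\<close> and the square \<open>(b - c)\<^sup>2\<close>.  Strictness is what makes the
  inequality survive a small perturbation of the coefficients.
\<close>

lemma eulerian_strictly_log_concave:
  assumes "1 \<le> i" "i \<le> n"
  shows "coeff (eulerian n) (i - 1) * coeff (eulerian n) (i + 1) < (coeff (eulerian n) i)\<^sup>2"
  using assms
proof (induction n arbitrary: i)
  case 0
  then show ?case by simp
next
  case (Suc n)
  show ?case
  proof (cases "i = 1")
    case True
    then show ?thesis using coeff_eulerian_pos[of 1 "Suc n"] Suc.prems by simp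
  next
    case False
    with Suc.prems obtain k where i: "i = Suc (Suc k)" and k: "Suc k \<le> n"
      by (cases i; cases "i - 1") auto
    define a b c d where "a = coeff (eulerian n) k" and "b = coeff (eulerian n) (Suc k)"
      and "c = coeff (eulerian n) (Suc (Suc k))" and "d = coeff (eulerian n) (Suc (Suc (Suc k)))"
    note abcd = a_def b_def c_def d_def
    define s t where "s = real k + 2" and "t = real n - real k"
    have s: "s \<ge> 2" and t: "t \<ge> 1" using k by (auto simp: s_def t_def)
    have pos: "a \<ge> 0" "b > 0" "c \<ge> 0" "d \<ge> 0"
      using k by (auto simp: abcd coeff_eulerian_nonneg coeff_eulerian_pos)
    have ac: "a * c < b\<^sup>2" using Suc.IH[of "Suc k"] k by (simp add: abcd)
    have e1: "coeff (eulerian (Suc n)) (i - 1) = (s - 1) * b + (t + 1) * a"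
      and e2: "coeff (eulerian (Suc n)) i = s * c + t * b"
      and e3: "coeff (eulerian (Suc n)) (i + 1) = (s + 1) * d + (t - 1) * c"
      by (simp_all add: i coeff_eulerian_Suc_Suc abcd s_def t_def algebra_simps)
    show ?thesis
    proof (cases "c = 0")
      case True
      then have "n < Suc (Suc k)"
        using coeff_eulerian_pos[of "Suc (Suc k)" n] by (force simp: c_def)
      then have "d = 0" by (simp add: d_def coeff_eulerian_eq_0)
      with True e1 e2 e3 pos t show ?thesis by simp
    next
      case False
      with pos have c: "c > 0" by simp
      then have "Suc (Suc k) \<le> n" using coeff_eulerian_eq_0[of n "Suc (Suc k)"] by (force simp: c_def)
      then have bd: "b * d < c\<^sup>2" using Suc.IH[of "Suc (Suc k)"] by (simp add: abcd)
      \<comment> \<open>Log-concavity across a gap: multiply the two adjacent inequalities and cancel \<open>b c > 0\<close>.\<close>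
      have "(a * d) * (b * c) \<le> b\<^sup>2 * c\<^sup>2"
        using mult_mono[of "a * c" "b\<^sup>2" "b * d" "c\<^sup>2"] ac bd pos by (simp add: mult_ac)
      then have "(a * d) * (b * c) \<le> (b * c) * (b * c)" by (simp add: power2_eq_square mult_ac)
      then have ad: "a * d \<le> b * c" using pos c by (simp add: mult_le_cancel_right)
      have "(s * c + t * b)\<^sup>2 - ((s - 1) * b + (t + 1) * a) * ((s + 1) * d + (t - 1) * c) =
        (s\<^sup>2 - 1) * (c\<^sup>2 - b * d) + (t\<^sup>2 - 1) * (b\<^sup>2 - a * c)
        + (s + 1) * (t + 1) * (b * c - a * d) + (b - c)\<^sup>2"
        by (simp add: power2_eq_square algebra_simps)
      moreover have "(s\<^sup>2 - 1) * (c\<^sup>2 - b * d) > 0"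
        using bd s power_mono[of 2 s 2] by (intro mult_pos_pos) auto
      moreover have "(t\<^sup>2 - 1) * (b\<^sup>2 - a * c) \<ge> 0"
        using ac t power_mono[of 1 t 2] by (intro mult_nonneg_nonneg) auto
      moreover have "(s + 1) * (t + 1) * (b * c - a * d) \<ge> 0"
        using ad s t by (intro mult_nonneg_nonneg) auto
      ultimately show ?thesis unfolding e1 e2 e3
        using zero_le_power2[of "b - c"] by linarith
    qed
  qed
qed

lemma poly_eulerian_1: "poly (eulerian n) 1 = fact n"
  by (induction n) (simp_all add: eulerian.simps(2))

lemma poly_eulerian_Suc:
  "poly (eulerian (Suc n)) x =
     x * ((1 - x) * poly (pderiv (eulerian n)) x + real (Suc n) * poly (eulerian n) x)"
  by (simp add: eulerian.simps(2) algebra_simps)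

section \<open>Alternating signs and real zeros\<close>

text \<open>
  The defining recursion in its analytic form: \<open>x F\<^sub>n'(x) = F\<^sub>n\<^sub>+\<^sub>1(x)\<close> for
  \<open>F\<^sub>n(x) = eulerian n x / (1 - x) ^ (n + 1)\<close>.  Up to known factors the derivative of \<open>F\<^sub>n\<close> is thus the next
  Eulerian polynomial, so that Rolle-type arguments pass from \<open>n\<close> to \<open>n + 1\<close>.
\<close>

lemma has_derivative_eulerian_quotient:
  fixes x :: real
  assumes "x < 1" "x \<noteq> 0"
  shows "((\<lambda>x. poly (eulerian n) x / (1 - x) ^ Suc n) has_real_derivative
    poly (eulerian (Suc n)) x / (x * (1 - x) ^ Suc (Suc n))) (at x)"
proof -
  have "((\<lambda>x. (1 - x) ^ Suc n) has_real_derivative real (Suc n) * (1 - x) ^ n * (- 1)) (at x)"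
    by (rule DERIV_cong[OF DERIV_power_Suc[where D = "- 1"]])
      (auto intro!: derivative_eq_intros simp: algebra_simps)
  then have "((\<lambda>x. poly (eulerian n) x / (1 - x) ^ Suc n) has_real_derivative
    (poly (pderiv (eulerian n)) x * (1 - x) ^ Suc n
      - poly (eulerian n) x * (real (Suc n) * (1 - x) ^ n * (- 1)))
      / ((1 - x) ^ Suc n * (1 - x) ^ Suc n)) (at x)"
    using assms by (intro DERIV_divide poly_DERIV) auto
  also have "(poly (pderiv (eulerian n)) x * (1 - x) ^ Suc n
      - poly (eulerian n) x * (real (Suc n) * (1 - x) ^ n * (- 1)))
      / ((1 - x) ^ Suc n * (1 - x) ^ Suc n) =
      ((1 - x) * poly (pderiv (eulerian n)) x + real (Suc n) * poly (eulerian n) x)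
        / (1 - x) ^ Suc (Suc n)"
    using assms by (simp add: divide_simps) (simp add: algebra_simps)
  also have "\<dots> = poly (eulerian (Suc n)) x / (x * (1 - x) ^ Suc (Suc n))"
    using assms by (simp add: poly_eulerian_Suc)
  finally show ?thesis .
qed

lemma poly_quotient_small_at_minus_infinity:
  fixes p :: "real poly"
  assumes "degree p \<le> n" "e > 0"
  shows "\<exists>x<y. \<bar>poly p x / (1 - x) ^ Suc n\<bar> < e"
proof -
  define C where "C = (\<Sum>i\<le>degree p. \<bar>coeff p i\<bar>)"
  have C: "C \<ge> 0" by (simp add: C_def sum_nonneg)
  define x where "x = min (y - 1) (- (C / e) - 1)"
  have Ce: "C / e \<ge> 0" using C assms by simp
  have x: "x < y" "x < 0" "(1 - x) > C / e"
    unfolding x_def using Ce by linarith+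
  have "\<bar>poly p x\<bar> \<le> (\<Sum>i\<le>degree p. \<bar>coeff p i\<bar> * \<bar>x\<bar> ^ i)"
    unfolding poly_altdef by (rule order_trans[OF sum_abs]) (simp add: abs_mult power_abs)
  also have "\<dots> \<le> (\<Sum>i\<le>degree p. \<bar>coeff p i\<bar> * (1 - x) ^ n)"
  proof (intro sum_mono mult_left_mono)
    fix i assume "i \<in> {..degree p}"
    have "\<bar>x\<bar> ^ i \<le> (1 - x) ^ i" using x by (intro power_mono) auto
    also have "\<dots> \<le> (1 - x) ^ n" using x assms \<open>i \<in> _\<close> by (intro power_increasing) auto
    finally show "\<bar>x\<bar> ^ i \<le> (1 - x) ^ n" .
  qed simp
  also have "\<dots> = C * (1 - x) ^ n" by (simp add: C_def sum_distrib_right)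
  also have "\<dots> < (e * (1 - x)) * (1 - x) ^ n"
    using x assms by (intro mult_strict_right_mono) (auto simp: field_simps)
  finally have "\<bar>poly p x / (1 - x) ^ Suc n\<bar> < e"
    using x by (simp add: abs_mult field_simps)
  with x show ?thesis by blast
qed

text \<open>
  Points of alternating sign stand in for simple real zeros, because they persist when the polynomial is
  perturbed.  In the induction step, each interval between neighbouring points contains a point at which
  \<open>F' = (eulerian n / (1 - x) ^ (n + 1))'\<close> has the sign of the difference quotient.  One further interval
  arises at the right end because \<open>F 0 = 0\<close>, and one at the left end because \<open>F\<close> tends to \<open>0\<close> at
  \<open>- \<infinity>\<close>; these two make the number of points grow by one.  The points are listed from right to left,
  with \<open>0\<close> in front.
\<close>

lemma eulerian_alternating_points:
  "\<exists>w :: nat \<Rightarrow> real. w 0 = 0 \<and> (\<forall>i<n. w (Suc i) < w i) \<and>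
     (\<forall>i. 1 \<le> i \<and> i \<le> n \<longrightarrow> (- 1) ^ i * poly (eulerian n) (w i) > 0)"
proof (induction n)
  case 0
  show ?case by (rule exI[of _ "\<lambda>_. 0"]) simp
next
  case (Suc n)
  show ?case
  proof (cases "n = 0")
    case True
    \<comment> \<open>Treated apart, since \<open>F 0 = 1\<close> for \<open>n = 0\<close>; the only new point is \<open>-1\<close>, and \<open>eulerian 1 = t\<close>.\<close>
    then show ?thesis by (intro exI[of _ "\<lambda>i. - real i"]) (auto simp: poly_eulerian_Suc)
  next
    case False
    then obtain n' where n': "n = Suc n'" by (cases n) auto
    from Suc.IH obtain w where w0: "w 0 = 0" and dec: "\<And>i. i < n \<Longrightarrow> w (Suc i) < w i"
      and alt: "\<And>i. 1 \<le> i \<Longrightarrow> i \<le> n \<Longrightarrow> (- 1) ^ i * poly (eulerian n) (w i) > 0"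
      by blast
    define F where "F x = poly (eulerian n) x / (1 - x) ^ Suc n" for x
    have w_le: "i \<le> n \<Longrightarrow> w i \<le> 0" for i
    proof (induction i)
      case (Suc i)
      then show ?case using dec[of i] by linarith
    qed (simp add: w0)
    have F0: "F (w 0) = 0" by (simp add: F_def w0 n' poly_eulerian_Suc)
    have F_alt: "(- 1) ^ i * F (w i) > 0" if "1 \<le> i" "i \<le> n" for i
      using alt[OF that] w_le[OF that(2)] by (simp add: F_def zero_less_mult_iff zero_less_divide_iff
        divide_less_0_iff)
    have "\<bar>F (w n)\<bar> > 0" using F_alt[of n] False by (auto simp: zero_less_mult_iff)
    then obtain l where l: "l < w n" "\<bar>F l\<bar> < \<bar>F (w n)\<bar>"
      using poly_quotient_small_at_minus_infinity[OF degree_eulerian_le, of "\<bar>F (w n)\<bar>" "w n" n]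
      unfolding F_def by blast
    \<comment> \<open>Append on the left a point \<open>l\<close> where \<open>\<bar>F\<bar>\<close> is smaller than at the leftmost old point.\<close>
    define v where "v = w(Suc n := l)"
    have v_dec: "v (Suc i) < v i" if "i \<le> n" for i
      using that dec[of i] l by (cases "i = n") (auto simp: v_def)
    have v_le: "v i \<le> 0" if "i \<le> n" for i using that w_le[of i] by (simp add: v_def)
    have drop: "(- 1) ^ i * (F (v i) - F (v (Suc i))) > 0" if "i \<le> n" for i
    proof (cases "i = n")
      case True
      have "(- 1) ^ n * F l < (- 1) ^ n * F (w n)"
        using l(2) F_alt[of n] False by (cases "even n") auto
      with True show ?thesis by (simp add: v_def algebra_simps)
    next
      case neq: False
      with that have "i < n" by simp
      then have 1: "(- 1) ^ i * F (w (Suc i)) < 0" using F_alt[of "Suc i"] by simp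
      have "(- 1) ^ i * F (w i) \<ge> 0" using F0 F_alt[of i] that by (cases "i = 0") auto
      with 1 \<open>i < n\<close> show ?thesis by (simp add: v_def algebra_simps)
    qed
    have "\<exists>c. v (Suc i) < c \<and> c < v i \<and> (- 1) ^ Suc i * poly (eulerian (Suc n)) c > 0"
      if "i \<le> n" for i
    proof -
      let ?D = "\<lambda>x. poly (eulerian (Suc n)) x / (x * (1 - x) ^ Suc (Suc n))"
      have cont: "continuous_on {v (Suc i)..v i} F"
        unfolding F_def using v_le[OF that] by (intro continuous_intros) auto
      have der: "(F has_derivative (*) (?D x)) (at x)" if "v (Suc i) < x" "x < v i" for x
        using has_derivative_eulerian_quotient[of x n] that v_le[OF \<open>i \<le> n\<close>]
        unfolding has_field_derivative_def F_def by (simp del: power_Suc)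
      obtain c where c: "v (Suc i) < c" "c < v i"
        and eq: "F (v i) - F (v (Suc i)) = ?D c * (v i - v (Suc i))"
        using mvt[OF v_dec[OF \<open>i \<le> n\<close>] cont, of "\<lambda>x. (*) (?D x)"] der by metis
      have "(v i - v (Suc i)) * ((- 1) ^ i * ?D c) > 0"
        using drop[OF that] unfolding eq by (simp add: mult_ac)
      then have "(- 1) ^ i * ?D c > 0"
        by (rule zero_less_mult_pos) (use v_dec[OF that] in simp)
      moreover have "c * (1 - c) ^ Suc (Suc n) < 0"
        using c v_le[OF that] by (intro mult_neg_pos zero_less_power) auto
      ultimately have "((- 1) ^ i * ?D c) * (c * (1 - c) ^ Suc (Suc n)) < 0"
        by (rule mult_pos_neg)
      then have "(- 1) ^ i * poly (eulerian (Suc n)) c < 0"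
        using c v_le[OF that] by simp
      with c show ?thesis by auto
    qed
    then obtain c where c: "\<And>i. i \<le> n \<Longrightarrow> v (Suc i) < c i \<and> c i < v i \<and>
      (- 1) ^ Suc i * poly (eulerian (Suc n)) (c i) > 0" by metis
    define u where "u i = (case i of 0 \<Rightarrow> 0 | Suc j \<Rightarrow> c j)" for i
    have "u (Suc i) < u i" if "i < Suc n" for i
      using that c[of i] c[of "i - 1"] v_le[of 0] by (cases i) (auto simp: u_def)
    moreover have "(- 1) ^ i * poly (eulerian (Suc n)) (u i) > 0" if "1 \<le> i" "i \<le> Suc n" for i
      using that c[of "i - 1"] by (cases i) (auto simp: u_def)
    ultimately show ?thesis by (intro exI[of _ u]) (simp add: u_def)
  qed
qed

lemma poly_map_poly_of_real:
  "poly (map_poly complex_of_real p) (of_real x) = of_real (poly p x)"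
  by (simp add: poly_altdef coeff_map_poly degree_map_poly)

lemma map_poly_of_real_cnj_root:
  assumes "poly (map_poly complex_of_real p) z = 0"
  shows "poly (map_poly complex_of_real p) (cnj z) = 0"
proof -
  have "poly (map_poly complex_of_real p) (cnj z) = cnj (poly (map_poly complex_of_real p) z)"
    by (simp add: poly_altdef coeff_map_poly degree_map_poly)
  with assms show ?thesis by simp
qed

text \<open>
  The \<open>n\<close> sign changes give \<open>n\<close> distinct real zeros.  A non-real zero would come with its conjugate, making
  \<open>n + 2\<close> distinct zeros, more than the degree allows.  So one sign change fewer than the degree suffices,
  and the leading coefficient may have either sign.
\<close>

lemma only_real_zeros_of_alternating_values:
  fixes p :: "real poly"
  assumes deg: "degree p \<le> Suc n"
    and dec: "\<And>i. i < n \<Longrightarrow> w (Suc i) < w i"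
    and alt: "\<And>i. i \<le> n \<Longrightarrow> (- 1) ^ i * poly p (w i) > 0"
  shows "only_real_zeros p"
  unfolding only_real_zeros_def
proof (intro allI impI, rule ccontr)
  fix z assume z: "poly (map_poly complex_of_real p) z = 0" "z \<notin> \<real>"
  have "\<exists>x. w (Suc i) < x \<and> x < w i \<and> poly p x = 0" if "i < n" for i
  proof -
    have "poly p (w i) * poly p (w (Suc i)) < 0"
      using alt[of i] alt[of "Suc i"] that
      by (cases "even i") (auto simp: mult_pos_neg mult_neg_pos)
    then show ?thesis
      using poly_IVT[OF dec[OF that], of p] by (auto simp: mult.commute)
  qed
  then obtain x where x: "\<And>i. i < n \<Longrightarrow> w (Suc i) < x i \<and> x i < w i \<and> poly p (x i) = 0"
    by metis
  have w_mono: "w j \<le> w i" if "i \<le> j" "j \<le> n" for i j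
  proof (rule inc_induct[OF that(1), where P = "\<lambda>k. w j \<le> w k"])
    fix k assume "k < j" "w j \<le> w (Suc k)"
    with dec[of k] that show "w j \<le> w k" by linarith
  qed simp
  have x_dec: "x j < x i" if "i < j" "j < n" for i j
    using x[of i] x[of j] w_mono[of "Suc i" j] that by force
  have inj: "inj_on x {..<n}"
    by (rule linorder_inj_onI') (use x_dec in force)
  let ?P = "map_poly complex_of_real p"
  let ?Z = "insert z (insert (cnj z) ((\<lambda>i. complex_of_real (x i)) ` {..<n}))"
  have "poly p (w 0) \<noteq> 0" using alt[of 0] by auto
  then have "p \<noteq> 0" by auto
  then have P: "?P \<noteq> 0" by (simp add: map_poly_eq_0_iff)
  have "cnj z \<noteq> z" using z(2) by (metis Reals_cnj_iff)
  moreover have "z \<noteq> of_real r" "cnj z \<noteq> of_real r" for r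
    using z(2) by (auto, metis Reals_of_real complex_cnj_cnj complex_cnj_complex_of_real)
  ultimately have "card ?Z = Suc (Suc n)"
    using inj by (subst card_insert_disjoint, simp, force, subst card_insert_disjoint, simp, force,
      subst card_image) (auto simp: inj_on_def)
  moreover have "?Z \<subseteq> {y. poly ?P y = 0}"
    using z(1) map_poly_of_real_cnj_root[OF z(1)] x by (auto simp: poly_map_poly_of_real)
  ultimately have "Suc (Suc n) \<le> card {y. poly ?P y = 0}"
    using card_mono[OF poly_roots_finite[OF P]] by metis
  also have "\<dots> \<le> degree ?P" by (rule card_poly_roots_bound[OF P])
  also have "\<dots> \<le> Suc n" using deg by (simp add: degree_map_poly)
  finally show False by simp
qed

section \<open>Rational series with a single pole\<close>

lemma fps_quotient_eq_iff:
  fixes F P :: "real fps"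
  shows "F = P / (1 - fps_X) ^ d \<longleftrightarrow> F * (1 - fps_X) ^ d = P"
proof -
  have U: "((1 - fps_X) ^ d :: real fps) $ 0 = 1" by (simp add: fps_power_zeroth)
  have "((1 - fps_X) ^ d :: real fps) \<noteq> 0" using U by (metis fps_zero_nth zero_neq_one)
  moreover have "P / (1 - fps_X) ^ d * (1 - fps_X) ^ d = P"
    using U by (simp add: fps_divide_unit mult.assoc inverse_mult_eq_1)
  ultimately show ?thesis by (metis mult_right_cancel)
qed

lemma h_polynomial_eqI:
  assumes "F * (1 - fps_X) ^ d = fps_of_poly p"
  shows "h_polynomial d F = p"
  unfolding h_polynomial_def
proof (rule the_equality)
  show "F = fps_of_poly p / (1 - fps_X) ^ d" using assms by (simp add: fps_quotient_eq_iff)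
  show "q = p" if "F = fps_of_poly q / (1 - fps_X) ^ d" for q
    using that assms by (simp add: fps_quotient_eq_iff fps_of_poly_eq_iff)
qed

lemma power_sums_fps:
  "Abs_fps (\<lambda>k. real k ^ n) * (1 - fps_X) ^ Suc n = fps_of_poly (eulerian n)"
proof (induction n)
  case 0
  show ?case
  proof (rule fps_ext)
    fix k show "(Abs_fps (\<lambda>k. real k ^ 0) * (1 - fps_X) ^ Suc 0) $ k = fps_of_poly (eulerian 0) $ k"
      by (cases k) (simp_all add: right_diff_distrib)
  qed
next
  case (Suc n)
  let ?S = "\<lambda>n. Abs_fps (\<lambda>k. real k ^ n)" and ?U = "1 - fps_X :: real fps"
  have S: "?S (Suc n) = fps_X * fps_deriv (?S n)"
    by (rule fps_ext) (simp add: fps_X_mult_nth del: of_nat_Suc)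
  have lin: "fps_of_poly [:1, -1:] = ?U" by (simp add: fps_of_poly_linear')
  have dU: "fps_deriv (?U ^ Suc n) = - (fps_const (real (Suc n)) * ?U ^ n)"
    by (simp add: fps_deriv_power del: power_Suc of_nat_Suc)
  have "fps_of_poly (pderiv (eulerian n)) = fps_deriv (?S n * ?U ^ Suc n)"
    unfolding Suc.IH by (simp add: fps_of_poly_pderiv)
  also have "\<dots> = fps_deriv (?S n) * ?U ^ Suc n - fps_const (real (Suc n)) * ?S n * ?U ^ n"
    unfolding fps_deriv_mult dU by (simp add: algebra_simps del: power_Suc of_nat_Suc)
  finally have pd: "fps_of_poly (pderiv (eulerian n)) =
    fps_deriv (?S n) * ?U ^ Suc n - fps_const (real (Suc n)) * ?S n * ?U ^ n" .
  have "?U * fps_of_poly (pderiv (eulerian n)) =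
      fps_deriv (?S n) * ?U ^ Suc (Suc n) - fps_const (real (Suc n)) * fps_of_poly (eulerian n)"
    unfolding Suc.IH[symmetric] pd by (subst right_diff_distrib) (simp add: mult_ac)
  then have "fps_X * (?U * fps_of_poly (pderiv (eulerian n))
      + fps_const (real (Suc n)) * fps_of_poly (eulerian n)) = ?S (Suc n) * ?U ^ Suc (Suc n)"
    unfolding S by (simp add: mult.assoc)
  then show ?case
    unfolding eulerian.simps(2) fps_of_poly_pCons[of 0] fps_of_poly_add fps_of_poly_mult fps_of_poly_smult lin
    by (simp add: mult.commute)
qed

text \<open>
  Partial fractions, in the basis of the series \<open>\<Sum>k. k ^ m t ^ k\<close>.  Since \<open>eulerian d\<close> takes the nonzero
  value \<open>d!\<close> at \<open>1\<close>, a multiple of \<open>\<Sum>k. k ^ d t ^ k\<close> removes the pole of order \<open>d + 1\<close>; what is left has a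
  numerator divisible by \<open>1 - t\<close>, hence a pole of order at most \<open>d\<close>.
\<close>

lemma quasi_polynomial_coefficients:
  fixes h :: "real poly"
  shows "\<exists>a q. \<forall>n. (fps_of_poly h / (1 - fps_X) ^ d) $ n = (\<Sum>m<d. a m * real n ^ m) + coeff q n"
proof (induction d arbitrary: h)
  case 0
  show ?case by auto
next
  case (Suc d)
  let ?U = "1 - fps_X :: real fps"
  define c where "c = poly h 1 / fact d"
  have "poly (h - smult c (eulerian d)) 1 = 0" by (simp add: c_def poly_eulerian_1)
  then have "[:-1, 1:] dvd h - smult c (eulerian d)" by (simp only: poly_eq_0_iff_dvd)
  then obtain g where "h - smult c (eulerian d) = [:-1, 1:] * g" by (rule dvdE)
  then have h: "h = smult c (eulerian d) + [:1, -1:] * (- g)" by (simp add: algebra_simps)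
  obtain a q where aq:
    "(fps_of_poly (- g) / ?U ^ d) $ n = (\<Sum>m<d. a m * real n ^ m) + coeff q n" for n
    using Suc.IH[of "- g"] by blast
  define F where "F = fps_of_poly (- g) / ?U ^ d"
  have F: "F * ?U ^ d = fps_of_poly (- g)" using fps_quotient_eq_iff F_def by blast
  have "(fps_const c * Abs_fps (\<lambda>k. real k ^ d) + F) * ?U ^ Suc d =
    fps_const c * (Abs_fps (\<lambda>k. real k ^ d) * ?U ^ Suc d) + ?U * (F * ?U ^ d)"
    by (simp add: algebra_simps)
  also have "\<dots> = fps_of_poly h"
    unfolding power_sums_fps F by (subst h) (simp only: fps_of_poly_add fps_of_poly_mult
      fps_of_poly_smult fps_of_poly_linear' fps_const_neg fps_const_1_eq_1, simp)
  finally have "fps_of_poly h / ?U ^ Suc d = fps_const c * Abs_fps (\<lambda>k. real k ^ d) + F"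
    by (metis fps_quotient_eq_iff)
  then have "(fps_of_poly h / ?U ^ Suc d) $ n =
      (\<Sum>m<Suc d. (a(d := c)) m * real n ^ m) + coeff q n" for n
    using aq[of n] by (simp add: F_def)
  then show ?case by blast
qed

section \<open>Krull dimension and growth\<close>

primrec monomials :: "'a::comm_monoid_mult set \<Rightarrow> nat \<Rightarrow> 'a set" where
  "monomials S 0 = {1}"
| "monomials S (Suc n) = (\<lambda>(s, m). s * m) ` (S \<times> monomials S n)"

lemma finite_monomials: "finite S \<Longrightarrow> finite (monomials S n)"
  by (induction n) auto

lemma monomials_mult:
  "x \<in> monomials S m \<Longrightarrow> y \<in> monomials S n \<Longrightarrow> x * y \<in> monomials S (m + n)"
  by (induction m arbitrary: x) (force simp: mult.assoc)+

text \<open>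
  Monomials in finitely many chosen elements are encoded by exponent lists, so that a chain of primes can
  be processed one element at a time by recursion on lists.
\<close>

definition power_product :: "'a::comm_monoid_mult list \<Rightarrow> nat list \<Rightarrow> 'a" where
  "power_product xs es = prod_list (map2 (^) xs es)"

lemma power_product_Nil [simp]: "power_product [] es = 1"
  and power_product_Cons [simp]: "power_product (x # xs) (e # es) = x ^ e * power_product xs es"
  by (simp_all add: power_product_def)

definition exponents :: "nat \<Rightarrow> nat \<Rightarrow> nat list set" where
  "exponents N n = {es. set es \<subseteq> {..N} \<and> length es = n}"

lemma finite_exponents: "finite (exponents N n)"
  and card_exponents: "card (exponents N n) = (N + 1) ^ n"
  using finite_lists_length_eq[of "{..N}" n] card_lists_length_eq[of "{..N}" n]
  by (simp_all add: exponents_def)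

lemma exponents_0: "exponents N 0 = {[]}"
  by (auto simp: exponents_def)

lemma exponents_Suc: "exponents N (Suc n) = (\<lambda>(a, es). a # es) ` ({..<Suc N} \<times> exponents N n)"
  by (auto simp: exponents_def length_Suc_conv image_iff less_Suc_eq_le)

lemma sum_exponents_Suc:
  "(\<Sum>es\<in>exponents N (Suc n). f es) = (\<Sum>a<Suc N. \<Sum>es\<in>exponents N n. f (a # es))"
proof -
  have "inj_on (\<lambda>(a, es). a # es) ({..<Suc N} \<times> exponents N n)" by (auto simp: inj_on_def)
  then show ?thesis
    unfolding exponents_Suc
    by (subst sum.reindex) (simp_all add: case_prod_unfold sum.cartesian_product del: sum.lessThan_Suc)
qed

context graded_algebra
begin

lemma scale_mult_right: "x * (c *s y) = c *s (x * y)"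
  by (metis mult.commute scale_mult_left)

lemma span_mult_closed:
  assumes prod: "\<And>x y. x \<in> X \<Longrightarrow> y \<in> Y \<Longrightarrow> x * y \<in> span Z"
    and x: "x \<in> span X" and y: "y \<in> span Y"
  shows "x * y \<in> span Z"
  using x
proof (induction rule: span_induct_alt)
  case base
  show ?case by (simp add: span_zero)
next
  case (step c a x)
  have "a * y \<in> span Z" using y
  proof (induction rule: span_induct_alt)
    case base
    show ?case by (simp add: span_zero)
  next
    case (step c b y)
    then show ?case using prod[OF \<open>a \<in> X\<close> \<open>b \<in> Y\<close>]
      by (simp add: distrib_left scale_mult_right span_add span_scale)
  qed
  with step show ?case by (simp add: distrib_right scale_mult_left span_add span_scale)
qed

text \<open>
  The step from \<open>Q\<close> to a smaller prime \<open>P\<close>.  In a relation \<open>\<Sum>a. x ^ a w\<^sub>a \<in> P\<close> with coefficients \<open>w\<^sub>a\<close>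
  in the span of \<open>f\<close>, all terms with \<open>a > 0\<close> lie in \<open>Q\<close>, so \<open>w\<^sub>0 \<in> Q\<close> and therefore \<open>w\<^sub>0 = 0\<close>.  Now \<open>x\<close>
  can be divided out because it is not in the prime \<open>P\<close>, and the argument repeats.
\<close>

lemma powers_independent_mod_prime:
  assumes P: "is_prime_ideal P" and Q: "is_prime_ideal Q" and "P \<subseteq> Q" "x \<in> Q" "x \<notin> P"
    and indep: "\<And>c i. (\<Sum>i\<in>I. c i *s f i) \<in> Q \<Longrightarrow> i \<in> I \<Longrightarrow> c i = 0"
    and "(\<Sum>a<k. x ^ a * (\<Sum>i\<in>I. c a i *s f i)) \<in> P" and "a < k" "i \<in> I"
  shows "c a i = 0"
  using assms(7-9)
proof (induction k arbitrary: a c)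
  case 0
  then show ?case by simp
next
  case (Suc k)
  let ?w = "\<lambda>a. \<Sum>i\<in>I. c a i *s f i"
  let ?t = "\<Sum>a<k. x ^ a * ?w (Suc a)"
  have split: "(\<Sum>a<Suc k. x ^ a * ?w a) = ?w 0 + x * ?t"
    by (simp only: sum.lessThan_Suc_shift sum_distrib_left) (simp add: mult.assoc)
  have Qadd: "u + v \<in> Q" if "u \<in> Q" "v \<in> Q" for u v using Q that by (auto simp: is_prime_ideal_def)
  have Qmult: "v * u \<in> Q" if "u \<in> Q" for u v using Q that by (auto simp: is_prime_ideal_def)
  have "?w 0 + x * ?t \<in> Q" using Suc.prems(1) \<open>P \<subseteq> Q\<close> split by auto
  moreover have "(- ?t) * x \<in> Q" by (rule Qmult) fact
  ultimately have "(?w 0 + x * ?t) + (- ?t) * x \<in> Q" by (rule Qadd)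
  then have "?w 0 \<in> Q" by (simp add: mult.commute)
  then have c0: "c 0 i = 0" if "i \<in> I" for i using indep that by blast
  then have "?w 0 = 0" by simp
  with Suc.prems(1) split have "x * ?t \<in> P" by simp
  with P \<open>x \<notin> P\<close> have "?t \<in> P" by (auto simp: is_prime_ideal_def)
  with Suc.IH[of "\<lambda>a. c (Suc a)" "a - 1"] Suc.prems(2,3) c0 show ?case by (cases a) auto
qed

text \<open>
  Elements \<open>x\<^sub>i \<in> P (i + 1) - P i\<close> are algebraically independent over the field, even modulo the smallest
  prime of the chain.
\<close>

lemma prime_chain_independent:
  assumes "\<And>i. i \<le> n \<Longrightarrow> is_prime_ideal (P i)" "\<And>i. i < n \<Longrightarrow> P i \<subset> P (Suc i)"
  shows "\<exists>xs. length xs = n \<and>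
    (\<forall>N c. (\<Sum>es\<in>exponents N n. c es *s power_product xs es) \<in> P 0 \<longrightarrow>
      (\<forall>es\<in>exponents N n. c es = 0))"
  using assms
proof (induction n arbitrary: P)
  case 0
  have "c = 0" if "c *s 1 \<in> P 0" for c
  proof (rule ccontr)
    assume "c \<noteq> 0"
    have *: "a * x \<in> P 0" if "x \<in> P 0" for a x
      using 0(1)[of 0] that by (auto simp: is_prime_ideal_def)
    have "inverse c *s 1 * (c *s 1) \<in> P 0" using *[OF that] .
    then have "1 \<in> P 0" using \<open>c \<noteq> 0\<close> by (simp add: scale_mult_left)
    then have "P 0 = UNIV" using *[of 1] by auto
    with 0(1)[of 0] show False by (auto simp: is_prime_ideal_def)
  qed
  then show ?case by (auto simp: exponents_0)
next
  case (Suc n)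
  from Suc.IH[of "\<lambda>i. P (Suc i)"] Suc.prems obtain xs where len: "length xs = n"
    and indep: "\<And>N c. (\<Sum>es\<in>exponents N n. c es *s power_product xs es) \<in> P (Suc 0) \<Longrightarrow>
      (\<forall>es\<in>exponents N n. c es = 0)" by auto
  from Suc.prems(2)[of 0] obtain x where x: "P 0 \<subseteq> P 1" "x \<in> P 1" "x \<notin> P 0" by auto
  have primes: "is_prime_ideal (P 0)" "is_prime_ideal (P 1)" using Suc.prems(1) by auto
  have "c es = 0" if "(\<Sum>es\<in>exponents N (Suc n). c es *s power_product (x # xs) es) \<in> P 0"
    and es: "es \<in> exponents N (Suc n)" for N c es
  proof -
    have "(\<Sum>es\<in>exponents N (Suc n). c es *s power_product (x # xs) es) =
      (\<Sum>a<Suc N. x ^ a * (\<Sum>es\<in>exponents N n. c (a # es) *s power_product xs es))"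
      unfolding sum_exponents_Suc by (simp add: sum_distrib_left scale_mult_right)
    with that(1) have sum: "(\<Sum>a<Suc N. x ^ a *
      (\<Sum>es\<in>exponents N n. c (a # es) *s power_product xs es)) \<in> P 0" by simp
    from es obtain a es' where "es = a # es'" "a < Suc N" "es' \<in> exponents N n"
      by (auto simp: exponents_Suc)
    with powers_independent_mod_prime[OF primes x _ sum, of a es'] indep show ?thesis by auto
  qed
  with len show ?case by (intro exI[of _ "x # xs"]) auto
qed

definition filtration :: "nat \<Rightarrow> 'a set" where
  "filtration N = span (\<Union>i\<le>N. G i)"

lemma filtration_mono: "M \<le> N \<Longrightarrow> filtration M \<subseteq> filtration N"
  unfolding filtration_def by (rule span_mono) force

lemma filtration_mult: "x \<in> filtration M \<Longrightarrow> y \<in> filtration N \<Longrightarrow> x * y \<in> filtration (M + N)"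
  unfolding filtration_def
proof (rule span_mult_closed)
  fix x y assume "x \<in> (\<Union>i\<le>M. G i)" "y \<in> (\<Union>i\<le>N. G i)"
  then obtain i j where "x \<in> G i" "i \<le> M" "y \<in> G j" "j \<le> N" by auto
  then have "x * y \<in> G (i + j)" "i + j \<le> M + N" by (auto intro: mult_in_component)
  then show "x * y \<in> span (\<Union>i\<le>M + N. G i)" by (auto intro!: span_base)
qed

lemma one_in_filtration: "1 \<in> filtration N"
  unfolding filtration_def by (rule span_base) (use one_in_component in auto)

lemma filtration_power: "x \<in> filtration K \<Longrightarrow> x ^ e \<in> filtration (K * e)"
  by (induction e) (auto simp: one_in_filtration intro: filtration_mult)

lemma filtration_power_product:
  assumes "set xs \<subseteq> filtration K" "es \<in> exponents N (length xs)"
  shows "power_product xs es \<in> filtration (length xs * (K * N))"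
  using assms
proof (induction xs arbitrary: es)
  case Nil
  show ?case by (simp add: one_in_filtration)
next
  case (Cons x xs)
  from Cons.prems(2) obtain e es' where es: "es = e # es'" "e \<le> N" "es' \<in> exponents N (length xs)"
    by (auto simp: exponents_Suc)
  have "x ^ e \<in> filtration (K * e)" using Cons.prems by (intro filtration_power) auto
  also have "\<dots> \<subseteq> filtration (K * N)" using es by (intro filtration_mono) simp
  finally show ?case using Cons.IH[OF _ es(3)] Cons.prems(1) es(1)
    by (auto intro: filtration_mult)
qed

end

context standard_graded_algebra
begin

text \<open>
  Degree \<open>n\<close> is spanned by the degree \<open>n\<close> monomials in the generators: all monomials span the algebra, and
  the sum of the components is direct.  Without finite dimension, \<open>dim\<close> would carry no information, as it is
  then \<open>0\<close> by convention.
\<close>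

lemma components_finitely_spanned: "\<exists>B. finite B \<and> B \<subseteq> G n \<and> G n \<subseteq> span B"
proof -
  from generated_in_degree_one obtain S where S: "finite S" "S \<subseteq> G 1"
    and hull: "is_subalgebra scale hull S = UNIV" by blast
  have sub: "monomials S i \<subseteq> G i" for i
  proof (induction i)
    case (Suc i)
    then show ?case using S(2) mult_in_component[of _ 1 _ i] by fastforce
  qed (simp add: one_in_component)
  let ?M = "\<Union>i. monomials S i"
  \<comment> \<open>The span of all monomials is a subalgebra containing the generators, hence everything.\<close>
  have "is_subalgebra scale (span ?M)"
    unfolding is_subalgebra_def
  proof (intro conjI ballI)
    show "1 \<in> span ?M" by (rule span_base) (auto intro: exI[of _ 0])
    show "x * y \<in> span ?M" if "x \<in> span ?M" "y \<in> span ?M" for x y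
    proof (rule span_mult_closed[OF _ that])
      fix x y assume "x \<in> ?M" "y \<in> ?M"
      then show "x * y \<in> span ?M" by (blast intro: span_base monomials_mult)
    qed
  qed simp
  moreover have "S \<subseteq> span ?M"
  proof
    fix s assume "s \<in> S"
    then have "s \<in> monomials S 1" by force
    then show "s \<in> span ?M" by (blast intro: span_base)
  qed
  ultimately have "span ?M = UNIV" using hull hull_minimal[of S "span ?M"] by blast
  have decomp: "\<exists>u N. (\<forall>i. u i \<in> span (monomials S i)) \<and> (\<forall>i>N. u i = 0) \<and> x = (\<Sum>i\<le>N. u i)"
    if "x \<in> span ?M" for x
    using that
  proof (induction rule: span_induct_alt)
    case base
    show ?case by (rule exI[of _ "\<lambda>_. 0"]) (simp add: span_zero)
  next
    case (step c m x)
    then obtain u N j where u: "\<And>i. u i \<in> span (monomials S i)" "\<And>i. i > N \<Longrightarrow> u i = 0"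
      "x = (\<Sum>i\<le>N. u i)" and j: "m \<in> monomials S j" by blast
    define v where "v i = (if i = j then c *s m else 0) + u i" for i
    have "(\<Sum>i\<le>max N j. u i) = (\<Sum>i\<le>N. u i)"
      by (rule sum.mono_neutral_right) (use u(2) in auto)
    then have "c *s m + x = (\<Sum>i\<le>max N j. v i)" by (simp add: v_def sum.distrib u(3))
    moreover have "v i \<in> span (monomials S i)" for i
      using u(1) j by (auto simp: v_def intro: span_add span_scale span_base)
    moreover have "v i = 0" if "i > max N j" for i using that u(2) by (simp add: v_def)
    ultimately show ?case by blast
  qed
  have "x \<in> span (monomials S n)" if "x \<in> G n" for x
  proof -
    obtain u N where u: "\<And>i. u i \<in> span (monomials S i)" "\<And>i. i > N \<Longrightarrow> u i = 0"
      "x = (\<Sum>i\<le>N. u i)" using decomp[of x] \<open>span ?M = UNIV\<close> by auto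
    have uG: "u i \<in> G i" for i using u(1) span_minimal[OF sub subspace_component] by blast
    have "(\<Sum>i\<le>max N n. u i) = (\<Sum>i\<le>N. u i)"
      by (rule sum.mono_neutral_right) (use u(2) in auto)
    then have "(\<Sum>i\<le>max N n. u i - (if i = n then x else 0)) = 0"
      by (simp add: sum_subtractf u(3))
    then have "u n - (if n = n then x else 0) = 0"
    proof (rule direct_sum[rotated])
      show "u i - (if i = n then x else 0) \<in> G i" for i
        using uG that by (auto intro: subspace_diff[OF subspace_component] subspace_0[OF subspace_component])
    qed simp
    with u(1)[of n] show ?thesis by simp
  qed
  with sub S show ?thesis by (intro exI[of _ "monomials S n"]) (auto intro: finite_monomials)
qed

lemma filtration_finitely_spanned:
  "\<exists>T. finite T \<and> card T \<le> (\<Sum>i\<le>N. dim (G i)) \<and> filtration N \<subseteq> span T"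
proof -
  have "\<exists>B. finite B \<and> card B = dim (G i) \<and> G i \<subseteq> span B" for i
  proof -
    obtain B where B: "B \<subseteq> G i" "independent B" "G i \<subseteq> span B" "card B = dim (G i)"
      by (rule basis_exists)
    obtain C where "finite C" "G i \<subseteq> span C" using components_finitely_spanned by blast
    then have "finite B" using independent_span_bound B by blast
    with B show ?thesis by blast
  qed
  then obtain B where B: "\<And>i. finite (B i)" "\<And>i. card (B i) = dim (G i)" "\<And>i. G i \<subseteq> span (B i)"
    by metis
  have "card (\<Union>i\<le>N. B i) \<le> (\<Sum>i\<le>N. dim (G i))"
    using card_UN_le[of "{..N}" B] B(2) by simp
  moreover have "G i \<subseteq> span (\<Union>i\<le>N. B i)" if "i \<le> N" for i
    using B(3)[of i] span_mono[of "B i" "\<Union>i\<le>N. B i"] that by blast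
  then have "filtration N \<subseteq> span (\<Union>i\<le>N. B i)"
    unfolding filtration_def by (intro span_minimal) auto
  ultimately show ?thesis using B(1) by (intro exI[of _ "\<Union>i\<le>N. B i"]) auto
qed

lemma filtration_exhaustive: "\<exists>K. x \<in> filtration K"
proof -
  have "x \<in> span (\<Union>n. G n)" by (simp add: exhaustive)
  then show ?thesis
  proof (induction rule: span_induct_alt)
    case base
    show ?case by (auto simp: filtration_def span_zero)
  next
    case (step c a x)
    then obtain i K where "a \<in> G i" "x \<in> filtration K" by auto
    then have "a \<in> filtration (max i K)"
      unfolding filtration_def by (intro span_base) auto
    moreover have "x \<in> filtration (max i K)"
      using filtration_mono[of K "max i K"] \<open>x \<in> filtration K\<close> by auto
    ultimately have "c *s a + x \<in> filtration (max i K)"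
      unfolding filtration_def by (intro span_add span_scale)
    then show ?case ..
  qed
qed

text \<open>
  Krull dimension bounds the growth of the filtration from below: the \<open>(N + 1) ^ n\<close> monomials with exponents
  at most \<open>N\<close> in the elements attached to the chain are linearly independent, and they lie in degrees at most
  \<open>n * k * N\<close> if each element lies in degrees at most \<open>k\<close>.
\<close>

lemma prime_chain_growth:
  fixes P :: "nat \<Rightarrow> 'b set"
  assumes "\<And>i. i \<le> n \<Longrightarrow> is_prime_ideal (P i)" "\<And>i. i < n \<Longrightarrow> P i \<subset> P (Suc i)"
  shows "\<exists>K. \<forall>N. (N + 1) ^ n \<le> (\<Sum>i\<le>K * N. dim (G i))"
proof -
  from prime_chain_independent[of n P, OF assms] obtain xs where len: "length xs = n"
    and indep: "\<And>N c. (\<Sum>es\<in>exponents N n. c es *s power_product xs es) \<in> P 0 \<Longrightarrow>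
      (\<forall>es\<in>exponents N n. c es = 0)" by auto
  from filtration_exhaustive obtain k where k: "\<And>x. x \<in> filtration (k x)" by metis
  define K where "K = Max (insert 0 (k ` set xs))"
  have xs: "set xs \<subseteq> filtration K"
  proof
    fix x assume "x \<in> set xs"
    then have "k x \<le> K" by (auto simp: K_def intro: Max_ge)
    with k[of x] filtration_mono show "x \<in> filtration K" by blast
  qed
  have zero: "0 \<in> P 0" using assms(1)[of 0] by (simp add: is_prime_ideal_def)
  have "(N + 1) ^ n \<le> (\<Sum>i\<le>n * K * N. dim (G i))" for N
  proof -
    let ?I = "exponents N n" and ?f = "power_product xs"
    have fin: "finite ?I" by (rule finite_exponents)
    \<comment> \<open>Two equal monomials would satisfy a relation with coefficients \<open>1\<close> and \<open>-1\<close>.\<close>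
    have inj: "inj_on ?f ?I"
    proof (rule inj_onI, rule ccontr)
      fix a b assume ab: "a \<in> ?I" "b \<in> ?I" "?f a = ?f b" "a \<noteq> b"
      define c :: "nat list \<Rightarrow> 'a" where "c es = (if es = a then 1 else if es = b then - 1 else 0)" for es
      have "(\<Sum>es\<in>?I. c es *s ?f es) =
        (\<Sum>es\<in>?I. (if es = a then ?f a else 0) + (if es = b then - ?f b else 0))"
        by (rule sum.cong) (use ab in \<open>auto simp: c_def\<close>)
      also have "\<dots> = 0" using ab fin by (simp add: sum.distrib)
      finally have "(\<Sum>es\<in>?I. c es *s ?f es) \<in> P 0" using zero by simp
      from indep[OF this] ab(1) have "c a = 0" by blast
      then show False by (simp add: c_def)
    qed
    have "independent (?f ` ?I)"
    proof (rule independent_if_scalars_zero)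
      fix c x assume sum: "(\<Sum>x\<in>?f ` ?I. c x *s x) = 0" and x: "x \<in> ?f ` ?I"
      have "(\<Sum>es\<in>?I. c (?f es) *s ?f es) \<in> P 0"
        using sum zero by (simp add: sum.reindex[OF inj])
      from indep[OF this] x show "c x = 0" by auto
    qed (simp add: fin)
    moreover have "?f ` ?I \<subseteq> filtration (n * K * N)"
      using filtration_power_product[OF xs] len by (auto simp: mult.assoc)
    moreover obtain T where "finite T" "card T \<le> (\<Sum>i\<le>n * K * N. dim (G i))"
      "filtration (n * K * N) \<subseteq> span T" using filtration_finitely_spanned by blast
    ultimately have "card (?f ` ?I) \<le> (\<Sum>i\<le>n * K * N. dim (G i))"
      using independent_span_bound[of T "?f ` ?I"] by force
    then show ?thesis by (simp add: card_image[OF inj] card_exponents)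
  qed
  then show ?thesis by blast
qed

lemma dim_component_0: "dim (G 0) = 1"
proof -
  have "G 0 = span {1}" by (simp add: component_zero span_singleton)
  then show ?thesis by (simp add: dim_eq_card_independent)
qed

end

text \<open>
  In \<open>enat\<close>, some member of the set exceeds \<open>d - 1\<close>, so there is a chain of length at least \<open>d\<close>, which
  can be truncated.
\<close>

lemma krull_dim_chain:
  assumes "krull_dim TYPE('a::comm_ring_1) = enat d" "d \<ge> 1"
  shows "\<exists>P :: nat \<Rightarrow> 'a set.
    (\<forall>i\<le>d. is_prime_ideal (P i)) \<and> (\<forall>i<d. P i \<subset> P (Suc i))"
proof -
  have "enat (d - 1) < krull_dim TYPE('a)" using assms by simp
  then obtain n and P :: "nat \<Rightarrow> 'a set" where "d - 1 < n"
    and "\<forall>i\<le>n. is_prime_ideal (P i)" "\<forall>i<n. P i \<subset> P (Suc i)"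
    unfolding krull_dim_def less_Sup_iff by fastforce
  with assms(2) show ?thesis by (intro exI[of _ P]) auto
qed

lemma power_sum_le: "(\<Sum>i\<le>M. real i ^ m) \<le> (real M + 1) ^ Suc m"
proof -
  have "(\<Sum>i\<le>M. real i ^ m) \<le> (\<Sum>i\<le>M. (real M + 1) ^ m)"
    by (intro sum_mono power_mono) auto
  then show ?thesis by (simp add: add.commute)
qed

text \<open>
  The term of degree \<open>n\<close> only lowers the sum, the terms of degree \<open>m < n\<close> contribute at most a multiple of
  \<open>(M + 1) ^ (m + 1) \<le> (M + 1) ^ n\<close>, and the correction \<open>q\<close> contributes a bounded amount.
\<close>

lemma cumulative_sum_bound:
  fixes a :: "nat \<Rightarrow> real"
  assumes "a n \<le> 0"
  shows "\<exists>C. \<forall>M. (\<Sum>i\<le>M. (\<Sum>m\<le>n. a m * real i ^ m) + coeff q i) \<le> C * (real M + 1) ^ n"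
proof -
  define D where "D = (\<Sum>m<n. \<bar>a m\<bar>)"
  define E where "E = (\<Sum>i\<le>degree q. \<bar>coeff q i\<bar>)"
  have "(\<Sum>i\<le>M. (\<Sum>m\<le>n. a m * real i ^ m) + coeff q i) \<le> (D + E) * (real M + 1) ^ n" for M
  proof -
    have "(\<Sum>i\<le>M. \<Sum>m\<le>n. a m * real i ^ m) = (\<Sum>m\<le>n. a m * (\<Sum>i\<le>M. real i ^ m))"
      by (subst sum.swap) (simp add: sum_distrib_left)
    also have "\<dots> = (\<Sum>m<n. a m * (\<Sum>i\<le>M. real i ^ m)) + a n * (\<Sum>i\<le>M. real i ^ n)"
      by (simp add: lessThan_Suc_atMost[symmetric])
    also have "\<dots> \<le> (\<Sum>m<n. \<bar>a m\<bar> * (real M + 1) ^ n) + 0"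
    proof (intro add_mono sum_mono)
      fix m assume "m \<in> {..<n}"
      have "a m * (\<Sum>i\<le>M. real i ^ m) \<le> \<bar>a m\<bar> * (\<Sum>i\<le>M. real i ^ m)"
        by (intro mult_right_mono) (auto intro: sum_nonneg)
      also have "\<dots> \<le> \<bar>a m\<bar> * (real M + 1) ^ Suc m"
        by (intro mult_left_mono power_sum_le) simp
      also have "\<dots> \<le> \<bar>a m\<bar> * (real M + 1) ^ n"
        using \<open>m \<in> _\<close> by (intro mult_left_mono power_increasing) auto
      finally show "a m * (\<Sum>i\<le>M. real i ^ m) \<le> \<bar>a m\<bar> * (real M + 1) ^ n" .
    next
      show "a n * (\<Sum>i\<le>M. real i ^ n) \<le> 0"
        using assms by (intro mult_nonpos_nonneg sum_nonneg) auto
    qed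
    finally have 1: "(\<Sum>i\<le>M. \<Sum>m\<le>n. a m * real i ^ m) \<le> D * (real M + 1) ^ n"
      by (simp add: D_def sum_distrib_right)
    have "(\<Sum>i\<le>M. coeff q i) \<le> (\<Sum>i\<le>M. \<bar>coeff q i\<bar>)" by (intro sum_mono) simp
    also have "\<dots> \<le> (\<Sum>i\<le>max M (degree q). \<bar>coeff q i\<bar>)" by (intro sum_mono2) auto
    also have "\<dots> = E" unfolding E_def by (intro sum.mono_neutral_right) (auto simp: coeff_eq_0)
    also have "E * 1 \<le> E * (real M + 1) ^ n"
      by (intro mult_left_mono) (auto simp: E_def sum_nonneg)
    finally have "(\<Sum>i\<le>M. coeff q i) \<le> E * (real M + 1) ^ n" by simp
    with 1 show ?thesis by (simp add: sum.distrib distrib_right)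
  qed
  then show ?thesis by blast
qed

text \<open>
  Otherwise the lower bound \<open>(N + 1) ^ (n + 1)\<close> from a chain of primes would contradict an upper
  bound of order \<open>N ^ n\<close>.
\<close>

lemma (in standard_graded_algebra) leading_coefficient_pos:
  assumes krull: "krull_dim TYPE('b) = enat (Suc n)"
    and hilbert: "\<And>k. real (dim (G k)) = (\<Sum>m\<le>n. a m * real k ^ m) + coeff q k"
  shows "a n > 0"
proof (rule ccontr)
  assume "\<not> a n > 0"
  then obtain C where C: "\<And>M. (\<Sum>i\<le>M. real (dim (G i))) \<le> C * (real M + 1) ^ n"
    using cumulative_sum_bound[of a n q] unfolding hilbert by auto
  obtain P :: "nat \<Rightarrow> 'b set" where P:
    "\<And>i. i \<le> Suc n \<Longrightarrow> is_prime_ideal (P i)" "\<And>i. i < Suc n \<Longrightarrow> P i \<subset> P (Suc i)"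
    using krull_dim_chain[OF krull] by auto
  from prime_chain_growth[of "Suc n" P, OF P] obtain K where
    K: "\<And>N. (N + 1) ^ Suc n \<le> (\<Sum>i\<le>K * N. dim (G i))" by blast
  have "real N + 1 \<le> C * (real K + 1) ^ n" for N
  proof -
    have C0: "C \<ge> 0"
    proof -
      have "0 \<le> (\<Sum>i\<le>0. real (dim (G i)))" by (intro sum_nonneg) simp
      with C[of 0] show ?thesis by simp
    qed
    have "(real N + 1) ^ Suc n = real ((N + 1) ^ Suc n)"
      by (simp add: add.commute del: power_Suc)
    also have "\<dots> \<le> real (\<Sum>i\<le>K * N. dim (G i))" using K[of N] by (simp only: of_nat_le_iff)
    also have "\<dots> \<le> C * (real (K * N) + 1) ^ n" using C[of "K * N"] by simp
    also have "\<dots> \<le> C * ((real K + 1) * (real N + 1)) ^ n"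
      using C0 by (intro mult_left_mono power_mono) (auto simp: algebra_simps)
    finally have "(real N + 1) * (real N + 1) ^ n \<le> (C * (real K + 1) ^ n) * (real N + 1) ^ n"
      by (simp only: power_Suc power_mult_distrib mult.assoc)
    then show ?thesis by (rule mult_right_le_imp_le) simp
  qed
  from this[of "nat \<lceil>C * (real K + 1) ^ n\<rceil>"] show False by linarith
qed

section \<open>Numerators of Veronese series\<close>

text \<open>
  The numerator over \<open>(1 - t) ^ (n + 1)\<close> of the series with coefficients \<open>\<Sum>m\<le>n. a m * (k * r) ^ m\<close>, changed
  by \<open>b\<close> in degree \<open>0\<close>.
\<close>

definition veronese_numerator :: "(nat \<Rightarrow> real) \<Rightarrow> real \<Rightarrow> nat \<Rightarrow> nat \<Rightarrow> real poly" where
  "veronese_numerator a b n r =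
    (\<Sum>m\<le>n. smult (a m * real r ^ m) (eulerian m * [:1, -1:] ^ (n - m))) + smult b ([:1, -1:] ^ Suc n)"

lemma veronese_numerator_fps:
  "Abs_fps (\<lambda>k. (\<Sum>m\<le>n. a m * real (k * r) ^ m) + (if k = 0 then b else 0)) * (1 - fps_X) ^ Suc n =
   fps_of_poly (veronese_numerator a b n r)"
proof -
  let ?S = "\<lambda>n. Abs_fps (\<lambda>k. real k ^ n)" and ?U = "1 - fps_X :: real fps"
  have lin: "fps_of_poly [:1, -1:] = ?U" by (simp add: fps_of_poly_linear')
  have "Abs_fps (\<lambda>k. (\<Sum>m\<le>n. a m * real (k * r) ^ m) + (if k = 0 then b else 0)) =
    (\<Sum>m\<le>n. fps_const (a m * real r ^ m) * ?S m) + fps_const b"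
    by (rule fps_ext) (simp add: fps_sum_nth power_mult_distrib mult_ac)
  also have "\<dots> * ?U ^ Suc n =
    (\<Sum>m\<le>n. fps_const (a m * real r ^ m) * ?S m * ?U ^ Suc n) + fps_const b * ?U ^ Suc n"
    by (simp only: distrib_right sum_distrib_right)
  also have "(\<Sum>m\<le>n. fps_const (a m * real r ^ m) * ?S m * ?U ^ Suc n) =
    (\<Sum>m\<le>n. fps_const (a m * real r ^ m) * (fps_of_poly (eulerian m) * ?U ^ (n - m)))"
  proof (rule sum.cong)
    fix m assume "m \<in> {..n}"
    then have "?U ^ Suc n = ?U ^ Suc m * ?U ^ (n - m)" by (simp flip: power_add)
    then show "fps_const (a m * real r ^ m) * ?S m * ?U ^ Suc n =
        fps_const (a m * real r ^ m) * (fps_of_poly (eulerian m) * ?U ^ (n - m))"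
      unfolding power_sums_fps[symmetric] by (simp add: mult.assoc)
  qed simp
  finally show ?thesis
    unfolding veronese_numerator_def
    by (simp only: fps_of_poly_add fps_of_poly_sum fps_of_poly_smult fps_of_poly_mult
      fps_of_poly_power lin)
qed

lemma degree_veronese_numerator: "degree (veronese_numerator a b n r) \<le> Suc n"
proof -
  have lin: "degree ([:1, -1:] ^ k :: real poly) \<le> k" for k
    using degree_power_le[of "[:1, -1::real:]" k] by simp
  show ?thesis
    unfolding veronese_numerator_def
  proof (intro degree_add_le degree_sum_le order_trans[OF degree_smult_le] lin)
    fix m assume "m \<in> {..n}"
    then show "degree (eulerian m * [:1, -1:] ^ (n - m)) \<le> Suc n"
      using degree_mult_le[of "eulerian m" "[:1, -1:] ^ (n - m)"] degree_eulerian_le[of m] lin[of "n - m"]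
      by simp
  qed simp
qed

text \<open>
  For \<open>n = 0\<close> the constant \<open>b\<close> would be of the same order as the leading term.
\<close>

lemma leading_term_tendsto:
  assumes "n \<ge> 1"
  shows "(\<lambda>r. ((\<Sum>m\<le>n. a m * real r ^ m * e m) + b) / real r ^ n) \<longlonglongrightarrow> a n * e n"
proof -
  have zero: "(\<lambda>r. real r ^ m / real r ^ n) \<longlonglongrightarrow> 0" if "m < n" for m
  proof -
    have "(\<lambda>r. inverse (real r) ^ (n - m)) \<longlonglongrightarrow> 0 ^ (n - m)"
      by (intro tendsto_power lim_inverse_n)
    moreover have "\<forall>\<^sub>F r in sequentially. inverse (real r) ^ (n - m) = real r ^ m / real r ^ n"
      using eventually_gt_at_top[of 0]
      by eventually_elim (use that in \<open>simp add: power_diff field_simps\<close>)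
    ultimately show ?thesis using that by (simp add: filterlim_cong zero_power)
  qed
  have "(\<lambda>r. (\<Sum>m<n. a m * e m * (real r ^ m / real r ^ n)) + a n * e n + b * (real r ^ 0 / real r ^ n))
    \<longlonglongrightarrow> (\<Sum>m<n. a m * e m * 0) + a n * e n + b * 0"
    using assms by (intro tendsto_intros zero) auto
  moreover have "\<forall>\<^sub>F r in sequentially.
    (\<Sum>m<n. a m * e m * (real r ^ m / real r ^ n)) + a n * e n + b * (real r ^ 0 / real r ^ n) =
    ((\<Sum>m\<le>n. a m * real r ^ m * e m) + b) / real r ^ n"
    using eventually_gt_at_top[of 0]
  proof eventually_elim
    case (elim r)
    then show ?case
      by (simp add: lessThan_Suc_atMost[symmetric] add_divide_distrib sum_divide_distrib mult_ac)
  qed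
  ultimately show ?thesis by (simp add: filterlim_cong)
qed

lemma coeff_veronese_numerator_tendsto:
  assumes "n \<ge> 1"
  shows "(\<lambda>r. coeff (veronese_numerator a b n r) i / real r ^ n) \<longlonglongrightarrow> a n * coeff (eulerian n) i"
  using leading_term_tendsto[OF assms, of a "\<lambda>m. coeff (eulerian m * [:1, -1:] ^ (n - m)) i"
      "b * coeff ([:1, -1:] ^ Suc n) i"]
  by (simp add: veronese_numerator_def coeff_sum del: power_Suc)

lemma poly_veronese_numerator_tendsto:
  assumes "n \<ge> 1"
  shows "(\<lambda>r. poly (veronese_numerator a b n r) x / real r ^ n) \<longlonglongrightarrow> a n * poly (eulerian n) x"
  using leading_term_tendsto[OF assms, of a "\<lambda>m. poly (eulerian m * [:1, -1:] ^ (n - m)) x"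
      "b * poly ([:1, -1:] ^ Suc n) x"]
  by (simp add: veronese_numerator_def poly_sum del: power_Suc)

text \<open>
  Positivity is asked only for the entries before the last.  The numerator of a Veronese series may have a
  zero or negative coefficient at \<open>t ^ d\<close>, and this does no harm, since such a last entry lies below its
  predecessor.  The peak is the first index after which the sequence does not increase.
\<close>

lemma unimodal_if_positive_log_concave:
  assumes lc: "log_concave_seq d c" and pos: "\<And>i. i < d \<Longrightarrow> c i > 0"
  shows "unimodal_seq d c"
proof -
  define j where "j = (LEAST j. j = d \<or> c j \<ge> c (j + 1))"
  have j: "j = d \<or> c j \<ge> c (j + 1)"
    unfolding j_def by (rule LeastI[of _ d]) simp
  have "j \<le> d" unfolding j_def by (rule Least_le) simp
  have up: "c i \<le> c (i + 1)" if "i < j" for i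
    using not_less_Least[of i "\<lambda>j. j = d \<or> c j \<ge> c (j + 1)"] that unfolding j_def by auto
  have down: "j \<le> i \<Longrightarrow> i < d \<Longrightarrow> c (i + 1) \<le> c i" for i
  proof (induction i rule: dec_induct)
    case base
    with j show ?case by auto
  next
    case (step i)
    have "c (Suc i + 1) \<le> c (Suc i)" if "c (Suc i + 1) > 0"
    proof -
      have "c (Suc i) * c (Suc i + 1) \<le> c i * c (Suc i + 1)"
        using step that by (intro mult_right_mono) auto
      also have "\<dots> \<le> c (Suc i) * c (Suc i)"
        using lc step.prems unfolding log_concave_seq_def
        by (auto simp: power2_eq_square dest!: spec[of _ "Suc i"])
      finally show ?thesis using pos[OF step.prems] by simp
    qed
    with pos[OF step.prems] show ?case by linarith
  qed
  show ?thesis unfolding unimodal_seq_def using \<open>j \<le> d\<close> up down by blast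
qed

text \<open>
  Each conclusion follows from finitely many strict inequalities, which hold for \<open>eulerian n\<close> at the indices
  \<open>1, \<dots>, n\<close> and are therefore inherited from the limit for large \<open>r\<close>.  The index \<open>0\<close> is not controlled by the limit,
  where the constant coefficient vanishes for \<open>n \<ge> 1\<close>; there the exact value \<open>a 0 + b = 1\<close> is used.  When
  \<open>n = 0\<close>, that value alone is enough.
\<close>

lemma veronese_numerator_eventually:
  assumes a: "a n > 0" and ab: "a 0 + b = 1"
  shows "\<forall>\<^sub>F r in sequentially. let p = veronese_numerator a b n r in
    (\<forall>i\<le>n. coeff p i \<ge> 1) \<and> only_real_zeros p \<and> log_concave_seq (Suc n) (coeff p)"
proof -
  let ?p = "veronese_numerator a b n" and ?E = "\<lambda>i. coeff (eulerian n) i"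
  have p0: "poly (?p r) 0 = 1" for r
  proof -
    have "fps_of_poly (?p r) $ 0 = (\<Sum>m\<le>n. a m * 0 ^ m) + b"
      unfolding veronese_numerator_fps[symmetric] by (simp add: fps_power_zeroth)
    also have "(\<Sum>m\<le>n. a m * 0 ^ m) = a 0" by (simp add: power_0_left sum.delta' if_distrib cong: if_cong)
    finally show ?thesis using ab by (simp add: poly_0_coeff_0)
  qed
  obtain w :: "nat \<Rightarrow> real" where w: "w 0 = 0" "\<And>i. i < n \<Longrightarrow> w (Suc i) < w i"
    and alt: "\<And>i. 1 \<le> i \<Longrightarrow> i \<le> n \<Longrightarrow> (- 1) ^ i * poly (eulerian n) (w i) > 0"
    using eulerian_alternating_points[of n] by blast
  \<comment> \<open>The coefficients grow like \<open>r ^ n\<close>.\<close>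
  have "\<forall>\<^sub>F r in sequentially. \<forall>i\<in>{1..n}. coeff (?p r) i \<ge> 1"
  proof (intro eventually_ball_finite ballI)
    fix i assume i: "i \<in> {1..n}"
    have "a n * ?E i > 0" using a i coeff_eulerian_pos[of i n] by simp
    moreover have "filterlim (\<lambda>r. real r ^ n) at_top sequentially"
      using i by (intro filterlim_pow_at_top filterlim_real_sequentially) auto
    ultimately have "filterlim (\<lambda>r. coeff (?p r) i / real r ^ n * real r ^ n) at_top sequentially"
      using i by (intro filterlim_tendsto_pos_mult_at_top[OF coeff_veronese_numerator_tendsto]) auto
    then have "\<forall>\<^sub>F r in sequentially. coeff (?p r) i / real r ^ n * real r ^ n \<ge> 1"
      by (simp only: filterlim_at_top)
    then show "\<forall>\<^sub>F r in sequentially. coeff (?p r) i \<ge> 1"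
      using eventually_gt_at_top[of 0] by eventually_elim simp
  qed simp
  moreover have "\<forall>\<^sub>F r in sequentially. \<forall>i\<in>{1..n}. (- 1) ^ i * poly (?p r) (w i) > 0"
  proof (intro eventually_ball_finite ballI)
    fix i assume i: "i \<in> {1..n}"
    have "(\<lambda>r. (- 1) ^ i * (poly (?p r) (w i) / real r ^ n)) \<longlonglongrightarrow> (- 1) ^ i * (a n * poly (eulerian n) (w i))"
      using i by (intro tendsto_intros poly_veronese_numerator_tendsto) auto
    moreover have "(- 1) ^ i * (a n * poly (eulerian n) (w i)) > 0"
      using mult_pos_pos[OF a alt[of i]] i by (simp add: mult_ac)
    ultimately have "\<forall>\<^sub>F r in sequentially. (- 1) ^ i * (poly (?p r) (w i) / real r ^ n) > 0"
      by (rule order_tendstoD)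
    then show "\<forall>\<^sub>F r in sequentially. (- 1) ^ i * poly (?p r) (w i) > 0"
      using eventually_gt_at_top[of 0]
      by eventually_elim (simp add: zero_less_divide_iff)
  qed simp
  moreover have "\<forall>\<^sub>F r in sequentially. \<forall>i\<in>{1..n}.
    coeff (?p r) (i - 1) * coeff (?p r) (i + 1) < (coeff (?p r) i)\<^sup>2"
  proof (intro eventually_ball_finite ballI)
    fix i assume i: "i \<in> {1..n}"
    let ?c = "\<lambda>r i. coeff (?p r) i / real r ^ n"
    have lim: "(\<lambda>r. (?c r i)\<^sup>2 - ?c r (i - 1) * ?c r (i + 1)) \<longlonglongrightarrow>
      (a n * ?E i)\<^sup>2 - (a n * ?E (i - 1)) * (a n * ?E (i + 1))"
      using i by (intro tendsto_intros coeff_veronese_numerator_tendsto) auto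
    have "(a n * ?E i)\<^sup>2 - (a n * ?E (i - 1)) * (a n * ?E (i + 1)) =
      (a n)\<^sup>2 * ((?E i)\<^sup>2 - ?E (i - 1) * ?E (i + 1))"
      by (simp add: power2_eq_square algebra_simps)
    moreover have "\<dots> > 0"
      using a i eulerian_strictly_log_concave[of i n] by (intro mult_pos_pos) auto
    ultimately have "\<forall>\<^sub>F r in sequentially. (?c r i)\<^sup>2 - ?c r (i - 1) * ?c r (i + 1) > 0"
      by (intro order_tendstoD(1)[OF lim]) linarith
    then show "\<forall>\<^sub>F r in sequentially. coeff (?p r) (i - 1) * coeff (?p r) (i + 1) < (coeff (?p r) i)\<^sup>2"
      using eventually_gt_at_top[of 0]
      by eventually_elim (simp add: power2_eq_square zero_less_divide_iff flip: diff_divide_distrib)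
  qed simp
  ultimately show ?thesis
  proof eventually_elim
    case (elim r)
    have "coeff (?p r) i \<ge> 1" if "i \<le> n" for i
      using elim(1) p0[of r] that by (cases "i = 0") (auto simp: poly_0_coeff_0)
    moreover have "only_real_zeros (?p r)"
    proof (rule only_real_zeros_of_alternating_values[OF degree_veronese_numerator])
      show "w (Suc i) < w i" if "i < n" for i by (rule w) fact
      show "(- 1) ^ i * poly (?p r) (w i) > 0" if "i \<le> n" for i
        using elim(2) p0[of r] w(1) that by (cases "i = 0") auto
    qed
    moreover have "log_concave_seq (Suc n) (coeff (?p r))"
      using elim(3) by (auto simp: log_concave_seq_def less_imp_le)
    ultimately show ?case by (simp add: Let_def)
  qed
qed

theorem corollary1p6:
  fixes scale :: "'k::field \<Rightarrow> 'a::comm_ring_1 \<Rightarrow> 'a"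
    and G :: "nat \<Rightarrow> 'a set"
    and d :: nat
    and h :: "real poly"
  assumes "standard_graded_algebra scale G"
    and "krull_dim TYPE('a) = enat d"
    and "d \<ge> 1"
    and "hilbert_series scale G = fps_of_poly h / (1 - fps_X) ^ d"
  shows "\<exists>R::nat. R > 0 \<and> (\<forall>r::nat. r > R \<longrightarrow>
    (let H = hilbert_series scale (veronese r G); hr = h_polynomial d H
     in H = fps_of_poly hr / (1 - fps_X) ^ d
      \<and> (\<forall>i. i \<le> d - 1 \<longrightarrow> coeff hr i \<ge> 1)
      \<and> (\<forall>i. i \<ge> d + 1 \<longrightarrow> coeff hr i = 0)
      \<and> only_real_zeros hr
      \<and> log_concave_seq d (coeff hr)
      \<and> unimodal_seq d (coeff hr)))"
proof -
  interpret standard_graded_algebra scale G by fact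
  obtain n where d: "d = Suc n" using assms(3) by (cases d) auto
  obtain a q where "\<And>k. (fps_of_poly h / (1 - fps_X) ^ d) $ k = (\<Sum>m<d. a m * real k ^ m) + coeff q k"
    using quasi_polynomial_coefficients by blast
  then have hilbert: "real (dim (G k)) = (\<Sum>m\<le>n. a m * real k ^ m) + coeff q k" for k
    unfolding assms(4)[symmetric] by (simp add: hilbert_series_def d lessThan_Suc_atMost)
  have a: "a n > 0" using leading_coefficient_pos[OF _ hilbert] assms(2) d by blast
  have "(\<Sum>m\<le>n. a m * real 0 ^ m) = a 0"
    by (simp add: power_0_left if_distrib cong: if_cong)
  \<comment> \<open>The degree \<open>0\<close> component is the field itself, of dimension \<open>1\<close>.\<close>
  then have ab: "a 0 + coeff q 0 = 1" using hilbert[of 0] dim_component_0 by simp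
  let ?p = "veronese_numerator a (coeff q 0) n"
  obtain R0 where R0: "\<And>r. r \<ge> R0 \<Longrightarrow> (\<forall>i\<le>n. coeff (?p r) i \<ge> 1) \<and> only_real_zeros (?p r) \<and>
      log_concave_seq (Suc n) (coeff (?p r))"
    using veronese_numerator_eventually[of a n "coeff q 0", OF a ab]
    unfolding eventually_sequentially Let_def by blast
  show ?thesis
  proof (intro exI[of _ "Suc (max R0 (degree q))"] conjI allI impI)
    fix r assume r: "r > Suc (max R0 (degree q))"
    let ?H = "hilbert_series scale (veronese r G)"
    \<comment> \<open>The indices \<open>r, 2 r, \<dots>\<close> all lie beyond the support of the correction.\<close>
    have "coeff q (k * r) = (if k = 0 then coeff q 0 else 0)" for k
    proof (cases "k = 0")
      case False
      then have "1 * r \<le> k * r" by (intro mult_right_mono) auto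
      with r have "degree q < k * r" by linarith
      with False show ?thesis by (simp add: coeff_eq_0)
    qed simp
    then have "?H = Abs_fps (\<lambda>k. (\<Sum>m\<le>n. a m * real (k * r) ^ m) + (if k = 0 then coeff q 0 else 0))"
      unfolding hilbert_series_def veronese_def hilbert by simp
    then have H: "?H * (1 - fps_X) ^ d = fps_of_poly (?p r)"
      unfolding d by (simp only: veronese_numerator_fps)
    then have H': "?H = fps_of_poly (?p r) / (1 - fps_X) ^ d" by (simp only: fps_quotient_eq_iff)
    have p: "h_polynomial d ?H = ?p r" by (rule h_polynomial_eqI[OF H])
    have props: "\<forall>i\<le>n. coeff (?p r) i \<ge> 1" "only_real_zeros (?p r)" "log_concave_seq d (coeff (?p r))"
      using R0[of r] r d by auto
    have "coeff (?p r) i = 0" if "i \<ge> d + 1" for i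
      using that d degree_veronese_numerator[of a "coeff q 0" n r] by (intro coeff_eq_0) linarith
    moreover have "unimodal_seq d (coeff (?p r))"
    proof (rule unimodal_if_positive_log_concave[OF props(3)])
      fix i assume "i < d"
      with props(1) d have "coeff (?p r) i \<ge> 1" by simp
      then show "coeff (?p r) i > 0" by linarith
    qed
    ultimately show "let H = ?H; hr = h_polynomial d H
     in H = fps_of_poly hr / (1 - fps_X) ^ d
      \<and> (\<forall>i. i \<le> d - 1 \<longrightarrow> coeff hr i \<ge> 1)
      \<and> (\<forall>i. i \<ge> d + 1 \<longrightarrow> coeff hr i = 0)
      \<and> only_real_zeros hr
      \<and> log_concave_seq d (coeff hr)
      \<and> unimodal_seq d (coeff hr)"
      unfolding Let_def p using props H' d by auto
  qed simp
qed

end
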